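(* Let $q=3^d$ with $d$ odd. Let $E\colon y^2=x^3+a_4x+a_6$ be an elliptic curve over $\mathbb{F}_q$ of Type $\mathrm{I}^+$, i.e. such that $a_4\in\mathbb{F}_q^\times$ is a fourth power in $\mathbb{F}_q^\times$. Then $E$ is isomorphic over $\mathbb{F}_q$ to the curve $y^2=x^3+x$. In particular all Type $\mathrm{I}^+$ curves over $\mathbb{F}_q$ are isomorphic over $\mathbb{F}_q$.
   Context: In characteristic $3$, every supersingular elliptic curve over $\mathbb{F}_q$ can be written as $y^2=x^3+a_4x+a_6$ with $a_4\neq0$. *)

theory Defs
  imports "HOL-Algebra.Algebraic_Closure_Type" "HOL-Library.Cardinality"
begin

text \<open>Points of the projective plane are lines through the origin with the origin removed.
  All geometric points are taken over the algebraic closure of the base field.\<close>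

type_synonym 'k coords = "'k \<times> 'k \<times> 'k"

definition proj_point :: "'k::field coords \<Rightarrow> 'k coords set" where
  "proj_point = (\<lambda>(x, y, z). {(c * x, c * y, c * z) | c. c \<noteq> 0})"

text \<open>The pair \<open>(a\<^sub>4, a\<^sub>6)\<close> stands for the projective plane curve
  \<open>Y\<^sup>2 Z = X\<^sup>3 + a\<^sub>4 X Z\<^sup>2 + a\<^sub>6 Z\<^sup>3\<close>, pointed by \<open>[0 : 1 : 0]\<close>.\<close>

type_synonym 'a short_weierstrass = "'a \<times> 'a"

definition on_curve :: "'a::field short_weierstrass \<Rightarrow> 'a alg_closure coords \<Rightarrow> bool" where
  "on_curve = (\<lambda>(a4, a6) (x, y, z). (x, y, z) \<noteq> (0, 0, 0) \<and>
     y^2 * z = x^3 + to_ac a4 * x * z^2 + to_ac a6 * z^3)"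

definition curve_points :: "'a::field short_weierstrass \<Rightarrow> 'a alg_closure coords set set" where
  "curve_points E = proj_point ` {V. on_curve E V}"

definition curve_origin :: "'k::field coords set" where
  "curve_origin = proj_point (0, 1, 0)"

text \<open>Nonsingularity, by the partial derivatives of
  \<open>Y\<^sup>2 Z - X\<^sup>3 - a\<^sub>4 X Z\<^sup>2 - a\<^sub>6 Z\<^sup>3\<close> with respect to \<open>X\<close>, \<open>Y\<close> and \<open>Z\<close>.\<close>

definition elliptic_curve :: "'a::field short_weierstrass \<Rightarrow> bool" where
  "elliptic_curve E \<longleftrightarrow> (case E of (a4, a6) \<Rightarrow>
     \<forall>x y z. on_curve E (x, y, z) \<longrightarrow>
       \<not> (- 3 * x^2 - to_ac a4 * z^2 = 0 \<and>
          2 * y * z = 0 \<and>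
          y^2 - 2 * to_ac a4 * x * z - 3 * to_ac a6 * z^2 = 0))"

text \<open>\<open>form_eval n f\<close> evaluates the ternary form of degree \<open>n\<close> over the base field in which
  \<open>f i j\<close> is the coefficient of \<open>X\<^sup>i Y\<^sup>j Z\<^bsup>n-i-j\<^esup>\<close>.\<close>

definition form_eval :: "nat \<Rightarrow> (nat \<Rightarrow> nat \<Rightarrow> 'a::field) \<Rightarrow> 'a alg_closure coords \<Rightarrow> 'a alg_closure" where
  "form_eval n f = (\<lambda>(x, y, z).
     \<Sum>i\<le>n. \<Sum>j\<le>n - i. to_ac (f i j) * x^i * y^j * z^(n - i - j))"

text \<open>A morphism over the base field is given, in a Zariski neighbourhood of every point, by
  forms of equal degree with coefficients in the base field. The neighbourhood can be taken to
  be the whole locus where the forms have no common zero, because the curves are irreducible.\<close>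

definition curve_morphism ::
    "'a::field short_weierstrass \<Rightarrow> 'a short_weierstrass \<Rightarrow>
     ('a alg_closure coords set \<Rightarrow> 'a alg_closure coords set) \<Rightarrow> bool" where
  "curve_morphism E E' \<phi> \<longleftrightarrow>
     \<phi> ` curve_points E \<subseteq> curve_points E' \<and>
     (\<forall>P. on_curve E P \<longrightarrow>
       (\<exists>n f g h. let \<Phi> = (\<lambda>V. (form_eval n f V, form_eval n g V, form_eval n h V)) in
          \<Phi> P \<noteq> (0, 0, 0) \<and>
          (\<forall>V. on_curve E V \<and> \<Phi> V \<noteq> (0, 0, 0) \<longrightarrow> \<phi> (proj_point V) = proj_point (\<Phi> V))))"

definition isomorphic_over_base ::
    "'a::field short_weierstrass \<Rightarrow> 'a short_weierstrass \<Rightarrow> bool" where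
  "isomorphic_over_base E E' \<longleftrightarrow>
     (\<exists>\<phi> \<psi>. curve_morphism E E' \<phi> \<and> curve_morphism E' E \<psi> \<and>
        (\<forall>P\<in>curve_points E. \<psi> (\<phi> P) = P) \<and>
        (\<forall>Q\<in>curve_points E'. \<phi> (\<psi> Q) = Q) \<and>
        \<phi> curve_origin = curve_origin)"

definition type_I_plus :: "'a::field short_weierstrass \<Rightarrow> bool" where
  "type_I_plus E \<longleftrightarrow> elliptic_curve E \<and> (\<exists>u. u \<noteq> 0 \<and> fst E = u^4)"

end

theory Submission
  imports Defs "HOL-Number_Theory.Residues"
begin

text \<open>In characteristic 3 the substitution \<open>x' = w\<^sup>2 x + s\<close>, \<open>y' = w\<^sup>3 y\<close> preserves the shape of
  the equation. It multiplies \<open>a\<^sub>4\<close> by \<open>w\<^sup>4\<close>, so \<open>w\<close> can be chosen to match two fourth powers; the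
  coefficients \<open>a\<^sub>6\<close> then match when \<open>s\<close> solves \<open>s\<^sup>3 + v\<^sup>4 s = c\<close>. The left-hand side is additive
  in \<open>s\<close>, and a nonzero root of it would make \<open>-1\<close> a square, which fails since \<open>q \<equiv> 3\<close> modulo 4.
  Hence it is injective, and by finiteness surjective.\<close>

text \<open>Multiplication by \<open>x\<close> permutes the nonzero elements, so it leaves their
  product unchanged; that product is nonzero and cancels.\<close>

lemma finite_field_power_card_minus_1:
  fixes x :: "'a::{field,finite}"
  assumes "x \<noteq> 0"
  shows "x ^ (CARD('a) - 1) = 1"
proof -
  let ?P = "\<Prod>y\<in>UNIV - {0::'a}. y"
  have "(\<Prod>y\<in>UNIV - {0}. x * y) = ?P"
    by (rule prod.reindex_bij_witness[of _ "\<lambda>y. y / x" "\<lambda>y. x * y"]) (use assms in auto)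
  then have "x ^ (CARD('a) - 1) * ?P = ?P"
    by (simp add: prod.distrib card_Diff_singleton)
  moreover have "?P \<noteq> 0"
    by (simp add: prod_zero_iff)
  ultimately show ?thesis
    by simp
qed

text \<open>Here \<open>CARD('a) - 1\<close> is twice an odd number, so a square root of -1 raised
  to this power would give both 1 and -1.\<close>

lemma minus_one_not_square:
  fixes x :: "'a::{field,finite}"
  assumes "CARD('a) mod 4 = 3" "(2::'a) \<noteq> 0"
  shows "x\<^sup>2 \<noteq> -1"
proof
  assume sq: "x\<^sup>2 = -1"
  obtain k where "CARD('a) = 4 * k + 3"
    using assms(1) by (metis mult_div_mod_eq)
  then have "CARD('a) - 1 = 2 * (2 * k + 1)"
    by simp
  moreover have "x \<noteq> 0"
    using sq by auto
  ultimately have "(x\<^sup>2) ^ (2 * k + 1) = 1"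
    by (metis finite_field_power_card_minus_1 power_mult)
  then have "(1::'a) + 1 = 0"
    by (simp add: sq power_mult add_eq_0_iff)
  with assms(2) show False
    by simp
qed

lemma cube_add_char3:
  fixes x y :: "'k::comm_ring_1"
  assumes "(3::'k) = 0"
  shows "(x + y)^3 = x^3 + y^3"
proof -
  have "(x + y)^3 = x^3 + y^3 + 3 * (x\<^sup>2 * y + x * y\<^sup>2)"
    by (simp add: power2_eq_square power3_eq_cube algebra_simps)
  then show ?thesis
    by (simp add: assms)
qed

lemma surj_cube_plus_linear:
  fixes v :: "'a::{field,finite}"
  assumes "(3::'a) = 0" "CARD('a) mod 4 = 3" "v \<noteq> 0"
  shows "\<exists>s. s^3 + v^4 * s = c"
proof -
  let ?f = "\<lambda>s. s^3 + v^4 * s"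
  have two: "(2::'a) \<noteq> 0"
  proof
    assume "(2::'a) = 0"
    moreover have "(3::'a) = 2 + 1"
      by simp
    ultimately show False
      using assms(1) by (metis add_0 zero_neq_one)
  qed
  have "inj ?f"
  proof (rule injI)
    fix s t assume eq: "?f s = ?f t"
    define k where "k = s - t"
    have "k * (k\<^sup>2 + v^4) = k^3 + v^4 * k"
      by (simp add: power2_eq_square power3_eq_cube algebra_simps)
    \<comment> \<open>Additivity of cubing on \<open>s = k + t\<close> gives
      \<open>k^3 = s^3 - t^3\<close>.\<close>
    also have "\<dots> = ?f s - ?f t"
      using cube_add_char3[OF assms(1), of k t] by (simp add: k_def right_diff_distrib)
    also have "\<dots> = 0"
      using eq by (simp only: diff_self)
    finally have *: "k * (k\<^sup>2 + v^4) = 0" .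
    have "k\<^sup>2 + v^4 \<noteq> 0"
    proof
      assume "k\<^sup>2 + v^4 = 0"
      then have "k\<^sup>2 = - (v^4)"
        by (rule eq_neg_iff_add_eq_0[THEN iffD2])
      \<comment> \<open>A fourth power is the square of a square, so dividing by it leaves a
        square.\<close>
      then have "(k / v\<^sup>2)\<^sup>2 = -1"
        using assms(3) by (simp add: power_divide)
      then show False
        using minus_one_not_square[OF assms(2) two] by blast
    qed
    with * show "s = t"
      by (simp add: k_def)
  qed
  then have "surj ?f"
    by (simp add: finite_UNIV_inj_surj)
  then obtain s where "c = ?f s"
    by (rule surjE)
  then show ?thesis
    by blast
qed

text \<open>Homogenized and acting on coordinate vectors, the substitution is linear; its image
  operator then acts on projective points.\<close>

definition weierstrass_map :: "'k::field \<Rightarrow> 'k \<Rightarrow> 'k coords \<Rightarrow> 'k coords" where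
  "weierstrass_map w s = (\<lambda>(x, y, z). (w\<^sup>2 * x + s * z, w^3 * y, z))"

lemma proj_point_weierstrass_map:
  "proj_point (weierstrass_map w s V) = weierstrass_map w s ` proj_point V"
proof -
  obtain x y z where V: "V = (x, y, z)"
    by (cases V)
  have "weierstrass_map w s (c * x, c * y, c * z) =
      (c * (w\<^sup>2 * x + s * z), c * (w^3 * y), c * z)" for c
    by (simp add: weierstrass_map_def algebra_simps)
  then show ?thesis
    by (auto simp: V proj_point_def weierstrass_map_def[of w s] image_iff; metis)
qed

lemma weierstrass_map_eq_0_iff:
  assumes "w \<noteq> 0"
  shows "weierstrass_map w s V = (0, 0, 0) \<longleftrightarrow> V = (0, 0, 0)"
  using assms by (cases V) (auto simp: weierstrass_map_def)

lemma weierstrass_map_inverse: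
  assumes "w \<noteq> 0"
  shows "weierstrass_map (inverse w) (- s / w\<^sup>2) (weierstrass_map w s V) = V"
  using assms by (cases V) (auto simp: weierstrass_map_def field_simps)

lemma to_ac_3_eq_0:
  assumes "(3::'a::field) = 0"
  shows "(3::'a alg_closure) = 0"
  by (metis assms to_ac_0 to_ac_numeral)

text \<open>The cube of \<open>w\<^sup>2 * x + s * z\<close> has no mixed terms in characteristic 3,
  so both sides of the equation are multiplied by \<open>w^6\<close>. The hypotheses on
  \<open>b4\<close> and \<open>b6\<close> match the coefficients of \<open>x * z\<^sup>2\<close> and
  \<open>z^3\<close>.\<close>

lemma on_curve_weierstrass_map:
  fixes w s a4 a6 b4 b6 :: "'a::field"
  assumes char: "(3::'a) = 0" and w: "w \<noteq> 0"
    and b4: "b4 = w^4 * a4" and b6: "w^6 * a6 = s^3 + b4 * s + b6"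
    and V: "on_curve (a4, a6) V"
  shows "on_curve (b4, b6) (weierstrass_map (to_ac w) (to_ac s) V)"
proof -
  obtain x y z where xyz: "V = (x, y, z)"
    by (cases V)
  define W S A4 A6 B4 B6 where defs: "W = to_ac w" "S = to_ac s" "A4 = to_ac a4"
    "A6 = to_ac a6" "B4 = to_ac b4" "B6 = to_ac b6"
  have W: "W \<noteq> 0"
    using w by (simp add: defs)
  have "W^6 * A6 = S^3 + B4 * S + B6"
    using arg_cong[OF b6, of to_ac] by (simp add: defs)
  then have B6: "B6 = W^6 * A6 - S^3 - B4 * S"
    by simp
  have B4: "B4 = W^4 * A4"
    by (simp add: defs b4)
  have "(W\<^sup>2 * x + S * z)^3 + B4 * (W\<^sup>2 * x + S * z) * z\<^sup>2 + B6 * z^3 =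
      (W\<^sup>2 * x)^3 + (S * z)^3 + B4 * (W\<^sup>2 * x + S * z) * z\<^sup>2 + B6 * z^3"
    by (simp only: cube_add_char3[OF to_ac_3_eq_0[OF char]])
  also have "\<dots> = W^6 * (x^3 + A4 * x * z\<^sup>2 + A6 * z^3)"
    unfolding B6 B4 by (simp add: algebra_simps power2_eq_square eval_nat_numeral)
  also have "x^3 + A4 * x * z\<^sup>2 + A6 * z^3 = y\<^sup>2 * z"
    using V by (simp add: xyz on_curve_def defs)
  finally have "(W^3 * y)\<^sup>2 * z =
      (W\<^sup>2 * x + S * z)^3 + B4 * (W\<^sup>2 * x + S * z) * z\<^sup>2 + B6 * z^3"
    by (simp add: power_mult_distrib mult.assoc)
  moreover have "weierstrass_map W S V \<noteq> (0, 0, 0)"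
    using V by (simp add: weierstrass_map_eq_0_iff[OF W] on_curve_def split: prod.splits)
  ultimately show ?thesis
    unfolding on_curve_def xyz weierstrass_map_def defs[symmetric] prod.case by simp
qed

text \<open>An invertible linear map vanishes at no point of the curve, so one triple of linear
  forms serves at every point.\<close>

lemma curve_morphism_weierstrass_map:
  fixes w s a4 a6 b4 b6 :: "'a::field"
  assumes "(3::'a) = 0" and w: "w \<noteq> 0"
    and "b4 = w^4 * a4" and "w^6 * a6 = s^3 + b4 * s + b6"
  shows "curve_morphism (a4, a6) (b4, b6) ((`) (weierstrass_map (to_ac w) (to_ac s)))"
proof -
  let ?T = "weierstrass_map (to_ac w) (to_ac s)"
  \<comment> \<open>In degree 1 the index pairs (1,0), (0,1), (0,0) carry the coefficients of X, Y,
    Z.\<close>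
  define f g h :: "nat \<Rightarrow> nat \<Rightarrow> 'a"
    where "f = (\<lambda>i j. if i = 1 then w\<^sup>2 else if j = 0 then s else 0)"
      and "g = (\<lambda>i j. if j = 1 then w^3 else 0)"
      and "h = (\<lambda>i j. if i = 0 \<and> j = 0 then 1 else 0)"
  have forms: "(form_eval 1 f V, form_eval 1 g V, form_eval 1 h V) = ?T V" for V
    by (cases V) (simp add: form_eval_def f_def g_def h_def weierstrass_map_def)
  have "?T ` proj_point V \<in> curve_points (b4, b6)" if "on_curve (a4, a6) V" for V
    using on_curve_weierstrass_map[OF assms that]
    by (auto simp: curve_points_def simp flip: proj_point_weierstrass_map)
  then have "((`) ?T) ` curve_points (a4, a6) \<subseteq> curve_points (b4, b6)"
    by (auto simp: curve_points_def[of "(a4, a6)"])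
  moreover have "?T P \<noteq> (0, 0, 0)" if "on_curve (a4, a6) P" for P
    using that w by (auto simp: weierstrass_map_eq_0_iff on_curve_def)
  ultimately show ?thesis
    unfolding curve_morphism_def Let_def
    by (metis forms proj_point_weierstrass_map)
qed

text \<open>The factor \<open>w^3\<close> is absorbed by projective scaling.\<close>

lemma weierstrass_map_curve_origin:
  assumes "w \<noteq> 0"
  shows "weierstrass_map w s ` curve_origin = curve_origin"
proof -
  have "weierstrass_map w s ` curve_origin = {(0, c * w^3, 0) | c. c \<noteq> 0}"
    by (auto simp: curve_origin_def proj_point_def weierstrass_map_def image_iff mult.commute)
  also have "\<dots> = curve_origin"
  proof -
    have "\<exists>c'. c = c' * w^3 \<and> c' \<noteq> 0" if "c \<noteq> 0" for c
      by (rule exI[of _ "c / w^3"]) (use assms that in simp)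
    then show ?thesis
      using assms by (auto simp: curve_origin_def proj_point_def)
  qed
  finally show ?thesis .
qed

lemma isomorphic_over_base_substitution:
  fixes w s a4 a6 b4 b6 :: "'a::field"
  assumes char: "(3::'a) = 0" and w: "w \<noteq> 0"
    and b4: "b4 = w^4 * a4" and b6: "w^6 * a6 = s^3 + b4 * s + b6"
  shows "isomorphic_over_base (a4, a6) (b4, b6)"
proof -
  \<comment> \<open>Solving the substitution for the old coordinates gives one of the same shape, so
    the same morphism lemma covers both directions.\<close>
  define w' s' where w's': "w' = inverse w" "s' = - s / w\<^sup>2"
  let ?T = "weierstrass_map (to_ac w) (to_ac s)"
  let ?U = "weierstrass_map (to_ac w') (to_ac s')"
  have w': "w' \<noteq> 0" and inv: "inverse w' = w" "- s' / w'\<^sup>2 = s"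
    using w by (simp_all add: w's' field_simps)
  have a4: "a4 = w'^4 * b4"
    using w by (simp add: w's' b4 field_simps)
  have a6: "w'^6 * b6 = s'^3 + a4 * s' + a6"
  proof -
    have "b6 = w^6 * a6 - s^3 - b4 * s"
      using b6 by simp
    then show ?thesis
      using w by (simp add: w's' b4 divide_simps) (simp add: algebra_simps eval_nat_numeral)
  qed
  have UT: "?U (?T V) = V" for V
    using weierstrass_map_inverse[of "to_ac w" "to_ac s" V] w by (simp add: w's')
  \<comment> \<open>Inverting the parameters twice returns the original ones, so the one-sided
    inverse law also yields the other composite.\<close>
  have "inverse (to_ac w') = to_ac w" "- to_ac s' / (to_ac w')\<^sup>2 = to_ac s"
    using arg_cong[OF inv(1), of to_ac] arg_cong[OF inv(2), of to_ac] by simp_all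
  then have TU: "?T (?U V) = V" for V
    using weierstrass_map_inverse[of "to_ac w'" "to_ac s'" V] w' by simp
  show ?thesis
    unfolding isomorphic_over_base_def
  proof (intro exI conjI ballI)
    show "curve_morphism (a4, a6) (b4, b6) ((`) ?T)"
      by (rule curve_morphism_weierstrass_map) fact+
    show "curve_morphism (b4, b6) (a4, a6) ((`) ?U)"
      by (rule curve_morphism_weierstrass_map) fact+
    show "?T ` curve_origin = curve_origin"
      using w by (simp add: weierstrass_map_curve_origin)
  qed (simp_all add: image_image UT TU)
qed

lemma isomorphic_over_base_fourth_powers:
  fixes u v a6 b6 :: "'a::{field,finite}"
  assumes "(3::'a) = 0" "CARD('a) mod 4 = 3" "u \<noteq> 0" "v \<noteq> 0"
  shows "isomorphic_over_base (u^4, a6) (v^4, b6)"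
proof -
  \<comment> \<open>With \<open>w = v / u\<close> the fourth powers match; this is the equation that
    the constant coefficients then impose on \<open>s\<close>.\<close>
  obtain s where "s^3 + v^4 * s = (v / u)^6 * a6 - b6"
    using surj_cube_plus_linear[OF assms(1,2,4)] by blast
  then have "(v / u)^6 * a6 = s^3 + v^4 * s + b6"
    by simp
  moreover have "v^4 = (v / u)^4 * u^4"
    using assms(3) by (simp add: power_divide)
  ultimately show ?thesis
    using assms by (intro isomorphic_over_base_substitution[where w = "v / u"]) auto
qed

theorem mainTheorem2:
  fixes d :: nat
  assumes "CARD('a::{field,finite}) = 3 ^ d" and "odd d"
  shows "(\<forall>E :: 'a short_weierstrass. type_I_plus E \<longrightarrow> isomorphic_over_base E (1, 0)) \<and>
         (\<forall>E E' :: 'a short_weierstrass. type_I_plus E \<and> type_I_plus E' \<longrightarrow>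
            isomorphic_over_base E E')"
proof -
  \<comment> \<open>The characteristic divides the cardinality \<open>3 ^ d\<close>.\<close>
  have "(3::'a) ^ d = 0"
    using CHAR_dvd_CARD[where 'a = 'a] assms(1)
    by (metis of_nat_eq_0_iff_char_dvd of_nat_numeral of_nat_power)
  then have char: "(3::'a) = 0"
    by simp
  \<comment> \<open>Oddness of \<open>d\<close> leaves one factor 3 beside a power of 9, and 9 is 1
    modulo 4.\<close>
  obtain k where "d = 2 * k + 1"
    using assms(2) oddE by blast
  then have "CARD('a) = 3 * 9 ^ k"
    by (simp add: assms(1) power_mult)
  moreover have "(9::nat) ^ k mod 4 = 1"
    using power_mod[of "9::nat" 4 k] by simp
  ultimately have card: "CARD('a) mod 4 = 3"
    by presburger
  show ?thesis
    \<comment> \<open>The general instance relates any two curves of the type; \<open>v = 1\<close>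
      gives the target \<open>(1, 0)\<close>.\<close>
    using isomorphic_over_base_fourth_powers[OF char card]
      isomorphic_over_base_fourth_powers[OF char card, where v = 1]
    by (auto simp: type_I_plus_def)
qed

end
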